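(* Let $K$ be a field of characteristic zero, let $n\ge5$, and let $\mathfrak{g}=\mathfrak{n}_n(K)$ be the Lie algebra of strictly upper-triangular $n\times n$-matrices over $K$, with underlying vector space $V$. Then every CPA-structure $(V,\cdot)$ on $\mathfrak{g}$ is associative, i.e. satisfies $\mathfrak{g}\cdot[\mathfrak{g},\mathfrak{g}]=0$, and the algebra $(V,\cdot)$ is Poisson-admissible. Moreover, $\mathfrak{g}\cdot\mathfrak{g}\subseteq\mathfrak{g}^{n-3}$.
   Context: The Lie bracket on $\mathfrak{n}_n(K)$ is the matrix commutator. The lower central series is indexed by $\mathfrak{g}^0=\mathfrak{g}$, $\mathfrak{g}^i=[\mathfrak{g},\mathfrak{g}^{i-1}]$ for $i\ge1$. A commutative post-Lie algebra structure (CPA-structure) on a Lie algebra $\mathfrak{g}=(V,[\,,])$ is a $K$-bilinear product $x\cdot y$ on $V$ such that for all $x,y,z\in V$: $x\cdot y=y\cdot x$; $[x,y]\cdot z=x\cdot(y\cdot z)-y\cdot(x\cdot z)$; $x\cdot[y,z]=[x\cdot y,z]+[y,x\cdot z]$. It is called associative if $\mathfrak{g}\cdot[\mathfrak{g},\mathfrak{g}]=0$. A Poisson algebra is a triple $(V,\circ,[\,,]_P)$ where $(V,\circ)$ is a commutative associative algebra, $(V,[\,,]_P)$ is a Lie algebra, and $[x,y\circ z]_P=[x,y]_P\circ z+y\circ[x,z]_P$ for all $x,y,z$. An algebra $(V,\cdot)$ (not assumed associative) is Poisson-admissible if $(V,\circ,[\,,]_P)$ with $[x,y]_P=x\cdot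 y-y\cdot x$ and $x\circ y=\frac12(x\cdot y+y\cdot x)$ is a Poisson algebra. *)

theory Defs
  imports "Jordan_Normal_Form.VS_Connect"
begin

text \<open>An algebra over a field: a vector space with a bilinear product, neither associative nor
  unital in general. The product is a separate parameter because the same space carries several
  (a bracket, a CPA-product, ...). The multiplicative fields of the record \<open>V\<close> are never used.\<close>

locale bilinear_algebra = vectorspace K V
  for K :: "('k, 'm) ring_scheme" and V :: "('k, 'v, 'n) module_scheme" +
  fixes p :: "'v \<Rightarrow> 'v \<Rightarrow> 'v"
  assumes p_closed: "\<lbrakk>x \<in> carrier V; y \<in> carrier V\<rbrakk> \<Longrightarrow> p x y \<in> carrier V"
    and p_add_left: "\<lbrakk>x \<in> carrier V; y \<in> carrier V; z \<in> carrier V\<rbrakk>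
      \<Longrightarrow> p (x \<oplus>\<^bsub>V\<^esub> y) z = p x z \<oplus>\<^bsub>V\<^esub> p y z"
    and p_add_right: "\<lbrakk>x \<in> carrier V; y \<in> carrier V; z \<in> carrier V\<rbrakk>
      \<Longrightarrow> p x (y \<oplus>\<^bsub>V\<^esub> z) = p x y \<oplus>\<^bsub>V\<^esub> p x z"
    and p_smult_left: "\<lbrakk>c \<in> carrier K; x \<in> carrier V; y \<in> carrier V\<rbrakk>
      \<Longrightarrow> p (c \<odot>\<^bsub>V\<^esub> x) y = c \<odot>\<^bsub>V\<^esub> p x y"
    and p_smult_right: "\<lbrakk>c \<in> carrier K; x \<in> carrier V; y \<in> carrier V\<rbrakk>
      \<Longrightarrow> p x (c \<odot>\<^bsub>V\<^esub> y) = c \<odot>\<^bsub>V\<^esub> p x y"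

locale lie_algebra = bilinear_algebra K V br
  for K :: "('k, 'm) ring_scheme" and V :: "('k, 'v, 'n) module_scheme" and br +
  assumes br_self: "x \<in> carrier V \<Longrightarrow> br x x = \<zero>\<^bsub>V\<^esub>"
    and jacobi: "\<lbrakk>x \<in> carrier V; y \<in> carrier V; z \<in> carrier V\<rbrakk>
      \<Longrightarrow> br x (br y z) \<oplus>\<^bsub>V\<^esub> br y (br z x) \<oplus>\<^bsub>V\<^esub> br z (br x y) = \<zero>\<^bsub>V\<^esub>"

text \<open>The linear span of all products of an element of \<open>A\<close> with an element of \<open>B\<close>;
  for a Lie bracket this is \<open>[A, B]\<close>.\<close>

definition product_space ::
  "('k, 'm) ring_scheme \<Rightarrow> ('k, 'v, 'n) module_scheme \<Rightarrow> ('v \<Rightarrow> 'v \<Rightarrow> 'v) \<Rightarrow> 'v set \<Rightarrow> 'v set \<Rightarrow> 'v set"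
  where "product_space K V p A B = LinearCombinations.module.span K V {p x y | x y. x \<in> A \<and> y \<in> B}"

primrec lower_central ::
  "('k, 'm) ring_scheme \<Rightarrow> ('k, 'v, 'n) module_scheme \<Rightarrow> ('v \<Rightarrow> 'v \<Rightarrow> 'v) \<Rightarrow> nat \<Rightarrow> 'v set"
  where
    "lower_central K V br 0 = carrier V"
  | "lower_central K V br (Suc i) = product_space K V br (carrier V) (lower_central K V br i)"

locale cpa_structure = lie_algebra K V br + cpa: bilinear_algebra K V p
  for K :: "('k, 'm) ring_scheme" and V :: "('k, 'v, 'n) module_scheme" and br p +
  assumes cpa_comm: "\<lbrakk>x \<in> carrier V; y \<in> carrier V\<rbrakk> \<Longrightarrow> p x y = p y x"
    and cpa_bracket_left: "\<lbrakk>x \<in> carrier V; y \<in> carrier V; z \<in> carrier V\<rbrakk>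
      \<Longrightarrow> p (br x y) z = p x (p y z) \<ominus>\<^bsub>V\<^esub> p y (p x z)"
    and cpa_derivation: "\<lbrakk>x \<in> carrier V; y \<in> carrier V; z \<in> carrier V\<rbrakk>
      \<Longrightarrow> p x (br y z) = br (p x y) z \<oplus>\<^bsub>V\<^esub> br y (p x z)"

definition cpa_associative ::
  "('k, 'm) ring_scheme \<Rightarrow> ('k, 'v, 'n) module_scheme \<Rightarrow> ('v \<Rightarrow> 'v \<Rightarrow> 'v) \<Rightarrow> ('v \<Rightarrow> 'v \<Rightarrow> 'v) \<Rightarrow> bool"
  where "cpa_associative K V br p \<longleftrightarrow>
    product_space K V p (carrier V) (product_space K V br (carrier V) (carrier V)) = {\<zero>\<^bsub>V\<^esub>}"

locale poisson_algebra = lie_algebra K V br + circ: bilinear_algebra K V circ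
  for K :: "('k, 'm) ring_scheme" and V :: "('k, 'v, 'n) module_scheme" and circ br +
  assumes circ_comm: "\<lbrakk>x \<in> carrier V; y \<in> carrier V\<rbrakk> \<Longrightarrow> circ x y = circ y x"
    and circ_assoc: "\<lbrakk>x \<in> carrier V; y \<in> carrier V; z \<in> carrier V\<rbrakk>
      \<Longrightarrow> circ (circ x y) z = circ x (circ y z)"
    and leibniz: "\<lbrakk>x \<in> carrier V; y \<in> carrier V; z \<in> carrier V\<rbrakk>
      \<Longrightarrow> br x (circ y z) = circ (br x y) z \<oplus>\<^bsub>V\<^esub> circ y (br x z)"

definition poisson_admissible ::
  "('k, 'm) ring_scheme \<Rightarrow> ('k, 'v, 'n) module_scheme \<Rightarrow> ('v \<Rightarrow> 'v \<Rightarrow> 'v) \<Rightarrow> bool"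
  where "poisson_admissible K V p \<longleftrightarrow>
    bilinear_algebra K V p \<and>
    poisson_algebra K V
      (\<lambda>x y. inv\<^bsub>K\<^esub> (\<one>\<^bsub>K\<^esub> \<oplus>\<^bsub>K\<^esub> \<one>\<^bsub>K\<^esub>) \<odot>\<^bsub>V\<^esub> (p x y \<oplus>\<^bsub>V\<^esub> p y x))
      (\<lambda>x y. p x y \<ominus>\<^bsub>V\<^esub> p y x)"

definition strict_upper :: "'a :: field itself \<Rightarrow> nat \<Rightarrow> ('a, 'a mat) module"
  where "strict_upper ty n = module_mat ty n n
    \<lparr>carrier := {A \<in> carrier_mat n n. \<forall>i<n. \<forall>j<n. j \<le> i \<longrightarrow> A $$ (i, j) = 0}\<rparr>"

definition mat_commutator :: "'a :: field mat \<Rightarrow> 'a mat \<Rightarrow> 'a mat"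
  where "mat_commutator A B = A * B - B * A"

lemma strict_upper_simps:
  "carrier (strict_upper TYPE('a :: field) n) =
    {A \<in> carrier_mat n n. \<forall>i<n. \<forall>j<n. j \<le> i \<longrightarrow> A $$ (i, j) = 0}"
  "add (strict_upper TYPE('a) n) = (+)"
  "zero (strict_upper TYPE('a) n) = 0\<^sub>m n n"
  "smult (strict_upper TYPE('a) n) = (\<cdot>\<^sub>m)"
  by (simp_all add: strict_upper_def module_mat_simps)

lemma strict_upper_vectorspace:
  "vectorspace (class_ring :: 'a :: field ring) (strict_upper TYPE('a) n)"
proof -
  let ?W = "carrier (strict_upper TYPE('a) n)"
  interpret M: vectorspace "class_ring :: 'a ring" "module_mat TYPE('a) n n"
    by (rule matrix_vs)
  have "submodule (class_ring :: 'a ring) ?W (module_mat TYPE('a) n n)"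
    by (unfold_locales) (auto simp: strict_upper_simps module_mat_simps)
  then have "subspace (class_ring :: 'a ring) ?W (module_mat TYPE('a) n n)"
    unfolding subspace_def using matrix_vs by blast
  then have "vectorspace (class_ring :: 'a ring) (module_mat TYPE('a) n n\<lparr>carrier := ?W\<rparr>)"
    by (rule M.subspace_is_vs)
  then show ?thesis by (simp add: strict_upper_def)
qed

lemma strict_upper_mult_closed:
  assumes "A \<in> carrier (strict_upper TYPE('a :: field) n)"
    and "B \<in> carrier (strict_upper TYPE('a) n)"
  shows "A * B \<in> carrier (strict_upper TYPE('a) n)"
proof -
  have A: "A \<in> carrier_mat n n" and B: "B \<in> carrier_mat n n"
    and A0: "\<And>i j. i < n \<Longrightarrow> j < n \<Longrightarrow> j \<le> i \<Longrightarrow> A $$ (i, j) = 0"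
    and B0: "\<And>i j. i < n \<Longrightarrow> j < n \<Longrightarrow> j \<le> i \<Longrightarrow> B $$ (i, j) = 0"
    using assms by (auto simp: strict_upper_simps)
  have "(A * B) $$ (i, j) = 0" if ij: "i < n" "j < n" "j \<le> i" for i j
  proof -
    have "(A * B) $$ (i, j) = (\<Sum>k = 0..<n. A $$ (i, k) * B $$ (k, j))"
      using A B ij by (auto simp: scalar_prod_def)
    also have "\<dots> = 0"
    proof (rule sum.neutral, rule ballI)
      fix k assume "k \<in> {0..<n}"
      then have k: "k < n" by simp
      show "A $$ (i, k) * B $$ (k, j) = 0"
      proof (cases "k \<le> i")
        case True then show ?thesis using A0[OF ij(1) k] by simp
      next
        case False then show ?thesis using B0[OF k ij(2)] ij(3) by simp
      qed
    qed
    finally show ?thesis .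
  qed
  then show ?thesis using A B by (simp add: strict_upper_simps)
qed

lemma strict_upper_minus_closed:
  assumes "A \<in> carrier (strict_upper TYPE('a :: field) n)"
    and "B \<in> carrier (strict_upper TYPE('a) n)"
  shows "A - B \<in> carrier (strict_upper TYPE('a) n)"
  using assms by (auto simp: strict_upper_simps)

lemma strict_upper_lie_algebra:
  "lie_algebra (class_ring :: 'a :: field ring) (strict_upper TYPE('a) n) mat_commutator"
proof (intro lie_algebra.intro bilinear_algebra.intro bilinear_algebra_axioms.intro
    lie_algebra_axioms.intro strict_upper_vectorspace, goal_cases)
  case (1 x y)
  then show ?case unfolding mat_commutator_def
    by (intro strict_upper_minus_closed strict_upper_mult_closed)
next
  case (2 x y z)
  then have c: "x \<in> carrier_mat n n" "y \<in> carrier_mat n n" "z \<in> carrier_mat n n"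
    by (simp_all add: strict_upper_simps)
  then show ?case unfolding mat_commutator_def strict_upper_simps
    add_mult_distrib_mat[OF c] mult_add_distrib_mat[OF c(3,1,2)]
    by (intro eq_matI) (auto simp del: index_mult_mat(1))
next
  case (3 x y z)
  then have c: "x \<in> carrier_mat n n" "y \<in> carrier_mat n n" "z \<in> carrier_mat n n"
    by (simp_all add: strict_upper_simps)
  then show ?case unfolding mat_commutator_def strict_upper_simps
    add_mult_distrib_mat[OF c(2,3,1)] mult_add_distrib_mat[OF c]
    by (intro eq_matI) (auto simp del: index_mult_mat(1))
next
  case (4 a x y)
  then have c: "x \<in> carrier_mat n n" "y \<in> carrier_mat n n"
    by (simp_all add: strict_upper_simps)
  then show ?case unfolding mat_commutator_def strict_upper_simps
    mult_smult_assoc_mat[OF c] mult_smult_distrib[OF c(2,1)]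
    by (intro eq_matI) (auto simp: right_diff_distrib simp del: index_mult_mat(1))
next
  case (5 a x y)
  then have c: "x \<in> carrier_mat n n" "y \<in> carrier_mat n n"
    by (simp_all add: strict_upper_simps)
  then show ?case unfolding mat_commutator_def strict_upper_simps
    mult_smult_assoc_mat[OF c(2,1)] mult_smult_distrib[OF c]
    by (intro eq_matI) (auto simp: right_diff_distrib simp del: index_mult_mat(1))
next
  case (6 x)
  then show ?case by (auto simp: mat_commutator_def strict_upper_simps)
next
  case (7 x y z)
  then have c: "x \<in> carrier_mat n n" "y \<in> carrier_mat n n" "z \<in> carrier_mat n n"
    by (simp_all add: strict_upper_simps)
  have e: "mat_commutator a (mat_commutator b d)
      = (a * b * d - a * d * b) - (b * d * a - d * b * a)"
    if "a \<in> carrier_mat n n" "b \<in> carrier_mat n n" "d \<in> carrier_mat n n" for a b d :: "'a mat"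
  proof -
    note [simp] = that
    have "a * (b * d - d * b) = a * (b * d) - a * (d * b)"
      by (rule mult_minus_distrib_mat[of _ n n _ n]) (auto intro: mult_carrier_mat[of _ n n])
    moreover have "(b * d - d * b) * a = b * d * a - d * b * a"
      by (rule minus_mult_distrib_mat[of _ n n _ _ n]) (auto intro: mult_carrier_mat[of _ n n])
    ultimately show ?thesis
      unfolding mat_commutator_def
      using assoc_mult_mat[OF that] assoc_mult_mat[OF that(1,3,2)] by simp
  qed
  show ?case unfolding strict_upper_simps e[OF c] e[OF c(2,3,1)] e[OF c(3,1,2)]
    using c by (intro eq_matI) (auto simp del: index_mult_mat(1))
qed

end

theory Submission
  imports Defs
begin

text \<open>Every left multiplication \<open>L(x)\<close> is a derivation. Applying derivations to
  \<open>[e\<^sub>i, e\<^sub>j] = 0\<close> for \<open>|i - j| \<ge> 2\<close> and to the cubic Serre relations of the generators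
  \<open>e\<^sub>i = E\<^sub>i\<^sub>,\<^sub>i\<^sub>+\<^sub>1\<close> shows that \<open>L(x) e\<^sub>i\<close> lives in row \<open>i\<close> and column \<open>i + 1\<close>, up to the three
  positions in the corner that span \<open>\<gg>\<^sup>n\<^sup>-\<^sup>3\<close>. Since \<open>e\<^sub>m \<cdot> e\<^sub>i = e\<^sub>i \<cdot> e\<^sub>m\<close>, outside the corner the only
  possible entries of \<open>e\<^sub>m \<cdot> e\<^sub>i\<close> are: \<open>e\<^sub>i\<close>, the last entry of row \<open>i\<close> and the first entry of column
  \<open>i + 1\<close> for \<open>m = i\<close>, and \<open>E\<^sub>i\<^sub>,\<^sub>i\<^sub>+\<^sub>2\<close>, with sign alternating in \<open>i\<close>, for \<open>m = i + 1\<close>. Comparing a few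
  entries in \<open>L([x, y]) = [L(x), L(y)]\<close> kills these one family after the other. Hence
  \<open>\<gg> \<cdot> \<gg> \<subseteq> \<gg>\<^sup>n\<^sup>-\<^sup>3\<close>, so \<open>L(x)\<close> raises the degree \<open>j - i\<close> of \<open>E\<^sub>i\<^sub>j\<close> by \<open>n - 3\<close>, and
  \<open>[x, y] \<cdot> z = x \<cdot> (y \<cdot> z) - y \<cdot> (x \<cdot> z)\<close> has degree at least \<open>1 + 2(n - 3) \<ge> n\<close>, that is,
  vanishes.\<close>

section \<open>Structure constants of a CPA-structure on strictly upper triangular matrices\<close>

text \<open>\<open>C k l a b i j\<close> stands for the entry \<open>(i, j)\<close> of the product of the matrix units \<open>E\<^sub>k\<^sub>l\<close> and
  \<open>E\<^sub>a\<^sub>b\<close>, with indices in \<open>{0..<n}\<close>. Only strictly upper triangular pairs \<open>(k, l)\<close>, \<open>(a, b)\<close> are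
  constrained.\<close>

locale cpa_constants =
  fixes n :: nat and C :: "nat \<Rightarrow> nat \<Rightarrow> nat \<Rightarrow> nat \<Rightarrow> nat \<Rightarrow> nat \<Rightarrow> 'a :: field_char_0"
  assumes n_ge: "n \<ge> 5"
    and upper: "\<lbrakk>k < l; l < n; a < b; b < n; i < n; j < n; j \<le> i\<rbrakk> \<Longrightarrow> C k l a b i j = 0"
    and swap: "\<lbrakk>k < l; l < n; a < b; b < n; i < n; j < n\<rbrakk> \<Longrightarrow> C k l a b i j = C a b k l i j"
    and product_rule: "\<lbrakk>k < l; l < n; a < b; b < d; d < n; i < n; j < n\<rbrakk> \<Longrightarrow>
      C k l a d i j = (if j = d then C k l a b i b else 0) - (if i = b then C k l a b d j else 0)
        + (if i = a then C k l b d b j else 0) - (if j = b then C k l b d i a else 0)"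
    and commute: "\<lbrakk>k < l; l < n; a < b; b < n; c < d; d < n; b \<noteq> c; d \<noteq> a; i < n; j < n\<rbrakk> \<Longrightarrow>
      (if j = d then C k l a b i c else 0) - (if i = c then C k l a b d j else 0)
        + (if i = a then C k l c d b j else 0) - (if j = b then C k l c d i a else 0) = 0"
    and rep: "\<lbrakk>k < l; l < n; a < b; b < d; d < n; i < n; j < n\<rbrakk> \<Longrightarrow>
      C a d k l i j = (\<Sum>(u, v)\<in>{..<n} \<times> {..<n}.
        C b d k l u v * C a b u v i j - C a b k l u v * C b d u v i j)"
begin

abbreviation P :: "nat \<Rightarrow> nat \<Rightarrow> nat \<Rightarrow> nat \<Rightarrow> 'a"
  where "P m i a b \<equiv> C m (Suc m) i (Suc i) a b"

abbreviation corner :: "nat \<Rightarrow> nat \<Rightarrow> bool"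
  where "corner a b \<equiv> a + n \<le> b + 2"

definition opp :: "nat \<Rightarrow> nat"
  where "opp x = n - 1 - x"

lemma opp_less: "opp x < n"
  using n_ge by (simp add: opp_def)

lemma opp_mono: "x < y \<Longrightarrow> y < n \<Longrightarrow> opp y < opp x"
  by (simp add: opp_def)

lemma opp_mono': "x \<le> y \<Longrightarrow> opp y \<le> opp x"
  by (simp add: opp_def)

lemma opp_eq_iff: "x < n \<Longrightarrow> y < n \<Longrightarrow> opp x = opp y \<longleftrightarrow> x = y"
  by (auto simp: opp_def)

lemma opp_opp: "x < n \<Longrightarrow> opp (opp x) = x"
  by (simp add: opp_def)

text \<open>The Lie algebra automorphism \<open>E\<^sub>a\<^sub>b \<mapsto> - E\<^sub>n\<^sub>-\<^sub>1\<^sub>-\<^sub>b\<^sub>,\<^sub>n\<^sub>-\<^sub>1\<^sub>-\<^sub>a\<close> transports CPA-structures, which halves the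
  case analysis below.\<close>

lemma mirror: "cpa_constants n (\<lambda>k l a b i j. - C (opp l) (opp k) (opp b) (opp a) (opp j) (opp i))"
proof -
  have neg_if: "(if Q then - x else 0) = - (if Q then x else 0)" for Q and x :: 'a by simp
  have lin4: "- x = - r - - t + - p - - q" if "x = p - q + r - t" for x p q r t :: 'a
    using that by simp
  have lin5: "- r - - t + - p - - q = 0" if "p - q + r - t = 0" for p q r t :: 'a
    using that by (simp add: algebra_simps)
  show ?thesis
  proof (unfold_locales, goal_cases)
    case 1 show ?case by (rule n_ge)
  next
    case (2 k l a b i j) then show ?case by (simp add: upper opp_less opp_mono opp_mono')
  next
    case (3 k l a b i j) then show ?case by (simp add: swap opp_less opp_mono)
  next
    case (4 k l a b d i j)
    then have less: "a < n" "b < n" "d < n" by auto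
    have "opp l < opp k" "opp d < opp b" "opp b < opp a" using 4 less by (simp_all add: opp_mono)
    note s = product_rule[OF this(1) opp_less this(2,3) opp_less opp_less opp_less, of j i]
    have e: "opp i = opp a \<longleftrightarrow> i = a" "opp i = opp b \<longleftrightarrow> i = b"
      "opp j = opp b \<longleftrightarrow> j = b" "opp j = opp d \<longleftrightarrow> j = d"
      using 4(6,7) less by (simp_all add: opp_eq_iff)
    show ?case using s unfolding e neg_if by (rule lin4)
  next
    case (5 k l a b c d i j)
    then have less: "a < n" "c < n" by auto
    have "opp l < opp k" "opp d < opp c" "opp b < opp a" using 5 by (simp_all add: opp_mono)
    moreover have "opp c \<noteq> opp b" "opp a \<noteq> opp d" using 5 less by (simp_all add: opp_eq_iff)
    ultimately have s: "(if opp i = opp a then C (opp l) (opp k) (opp d) (opp c) (opp j) (opp b) else 0)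
       - (if opp j = opp b then C (opp l) (opp k) (opp d) (opp c) (opp a) (opp i) else 0)
       + (if opp j = opp d then C (opp l) (opp k) (opp b) (opp a) (opp c) (opp i) else 0)
       - (if opp i = opp c then C (opp l) (opp k) (opp b) (opp a) (opp j) (opp d) else 0) = 0"
      by (intro commute opp_less)
    have e: "opp i = opp a \<longleftrightarrow> i = a" "opp j = opp b \<longleftrightarrow> j = b"
      "opp j = opp d \<longleftrightarrow> j = d" "opp i = opp c \<longleftrightarrow> i = c"
      using 5(4,6,9,10) less by (simp_all add: opp_eq_iff)
    show ?case using s unfolding e neg_if by (rule lin5)
  next
    case (6 k l a b d i j)
    then have "opp l < opp k" "opp d < opp b" "opp b < opp a" by (simp_all add: opp_mono)
    then have "C (opp d) (opp a) (opp l) (opp k) (opp j) (opp i) = (\<Sum>(u, v)\<in>{..<n} \<times> {..<n}.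
          C (opp b) (opp a) (opp l) (opp k) u v * C (opp d) (opp b) u v (opp j) (opp i)
          - C (opp d) (opp b) (opp l) (opp k) u v * C (opp b) (opp a) u v (opp j) (opp i))"
      by (intro rep opp_less)
    also have "\<dots> = (\<Sum>(u, v)\<in>{..<n} \<times> {..<n}.
          C (opp b) (opp a) (opp l) (opp k) (opp v) (opp u) * C (opp d) (opp b) (opp v) (opp u) (opp j) (opp i)
          - C (opp d) (opp b) (opp l) (opp k) (opp v) (opp u) * C (opp b) (opp a) (opp v) (opp u) (opp j) (opp i))"
      by (rule sum.reindex_bij_witness[of _ "\<lambda>(u, v). (opp v, opp u)" "\<lambda>(u, v). (opp v, opp u)"])
        (auto simp: opp_opp opp_less)
    finally show ?case by (simp add: sum_negf[symmetric] split_def)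
  qed
qed

section \<open>Images of the generators under a derivation\<close>

lemma off_low:
  assumes kl: "k < l" "l < n" and i: "i + 1 < n" and ab: "a < b" "b + 1 < n" "a \<noteq> i" "b \<noteq> i + 1"
    and ex: "\<not> (b = i \<and> i + 2 = n)"
  shows "C k l i (Suc i) a b = 0"
proof -
  \<comment> \<open>The cases use \<open>[e\<^sub>i, [e\<^sub>i, e\<^sub>i\<^sub>+\<^sub>1]] = 0\<close>, \<open>[e\<^sub>i, [e\<^sub>i\<^sub>-\<^sub>1, e\<^sub>i]] = 0\<close> and \<open>[e\<^sub>i, e\<^sub>b] = 0\<close>.\<close>
  consider "b = i" "i + 2 < n" | "b + 1 = i" | "b \<noteq> i" "b + 1 \<noteq> i" using ex i by linarith
  then show ?thesis
  proof cases
    case 1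
    then show ?thesis using commute[OF kl, of i "Suc i" i "i + 2" a "i + 2"] ab by auto
  next
    case 2
    have "C k l b (Suc i) a i = - C k l i (Suc i) a b"
      using product_rule[OF kl, of b i "Suc i" a i] 2 ab i by auto
    then have "2 * C k l i (Suc i) a b = 0"
      using commute[OF kl, of i "Suc i" b "Suc i" a "Suc i"] ab i 2 by auto
    then show ?thesis by simp
  next
    case 3
    then show ?thesis using commute[OF kl, of i "Suc i" b "Suc b" a "Suc b"] ab i by auto
  qed
qed

text \<open>Entry \<open>(i, b+1)\<close> of L(x) applied to \<open>[e_i, e_b] = 0\<close>. It ties
  an entry in row i of \<open>L(x) e_i\<close> to one in column b + 1 of \<open>L(x) e_b\<close>, so
  either vanishes with the other.\<close>

lemma shift:
  assumes kl: "k < l" "l < n" and "i + 2 \<le> b" "b + 1 < n"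
  shows "C k l b (Suc b) (Suc i) (Suc b) = - C k l i (Suc i) i b"
  using commute[OF kl, of i "Suc i" b "Suc b" i "Suc b"] assms by (auto simp: eq_neg_iff_add_eq_0 add.commute)

text \<open>What \<open>off_low\<close> leaves out is reached by reflection in the antidiagonal. In
  the last column, \<open>nc\<close> forces a \<ge> 2, so the reflected position avoids the last
  column.\<close>

lemma off:
  assumes kl: "k < l" "l < n" and i: "i + 1 < n" and ab: "a < b" "b < n" "a \<noteq> i" "b \<noteq> i + 1"
    and nc: "\<not> corner a b"
  shows "C k l i (Suc i) a b = 0"
proof (cases "b + 1 < n \<and> \<not> (b = i \<and> i + 2 = n)")
  case True
  then show ?thesis using off_low assms by blast
next
  case False
  interpret M: cpa_constants n "\<lambda>k l a b i j. - C (opp l) (opp k) (opp b) (opp a) (opp j) (opp i)"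
    by (rule mirror)
  let ?i = "opp (Suc i)"
  have si: "opp i = Suc ?i" using i by (simp add: opp_def)
  have "opp a \<noteq> Suc ?i" "opp b \<noteq> ?i" using ab i si by (simp_all add: opp_eq_iff flip: si)
  moreover have "Suc (opp a) < n" "\<not> (opp a = ?i \<and> Suc (Suc ?i) = n)"
    using ab i nc False n_ge by (auto simp: opp_def)
  moreover have "Suc ?i < n" using opp_less[of i] si by simp
  moreover have "opp b < opp a" "opp l < opp k" using ab kl by (simp_all add: opp_mono)
  ultimately have "C (opp (opp k)) (opp (opp l)) (opp (Suc ?i)) (opp ?i) (opp (opp a)) (opp (opp b)) = 0"
    using M.off_low[of "opp l" "opp k" ?i "opp b" "opp a"] opp_less[of k] by simp
  then show ?thesis using assms by (simp add: opp_opp flip: si)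
qed

section \<open>Products of two generators\<close>

lemma P_sym: "\<lbrakk>m + 1 < n; i + 1 < n; a < n; b < n\<rbrakk> \<Longrightarrow> P m i a b = P i m a b"
  by (rule swap) auto

text \<open>By commutativity, \<open>off\<close> constrains the product through either
  factor.\<close>

lemma P_off:
  assumes "m + 1 < n" "i + 1 < n" "a < b" "b < n" "\<not> corner a b"
    and "a \<noteq> i \<and> b \<noteq> i + 1 \<or> a \<noteq> m \<and> b \<noteq> m + 1"
  shows "P m i a b = 0"
  using assms(6)
proof
  assume "a \<noteq> i \<and> b \<noteq> i + 1"
  then show ?thesis using assms by (intro off) auto
next
  assume "a \<noteq> m \<and> b \<noteq> m + 1"
  then have "P i m a b = 0" using assms by (intro off) auto
  then show ?thesis using assms P_sym by auto
qed

text \<open>\<open>shift\<close> for \<open>L(e_i)\<close> trades this entry for one of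
  \<open>P i b\<close> off row i and column i + 1. The column version uses \<open>L(e_b)\<close>
  instead.\<close>

lemma P_square_row:
  assumes "i + 2 \<le> b" "b + 1 < n" "\<not> corner i b"
  shows "P i i i b = 0"
proof -
  have "P i b (Suc i) (Suc b) = 0" using assms by (intro P_off) auto
  then show ?thesis using shift[of i "Suc i" i b] assms by simp
qed

lemma P_square_col:
  assumes "i + 2 \<le> b" "b + 1 < n" "\<not> corner i b"
  shows "P b b (Suc i) (Suc b) = 0"
proof -
  have "P b i i b = 0" using assms by (intro P_off) auto
  then show ?thesis using shift[of b "Suc b" i b] assms by simp
qed

text \<open>\<open>shift\<close> moves the entry to a product of neighbours, where
  \<open>P_off\<close> applies: to \<open>e_m\<close> and \<open>e_(m+1)\<close> if the latter
  exists, otherwise to \<open>e_i\<close> and \<open>e_(i-1)\<close>. The latter exists because m =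
  n - 2 and i = 0 would give a corner position.\<close>

lemma P_distant:
  assumes "i + 2 \<le> m" "m + 1 < n" "\<not> corner i (Suc m)"
  shows "P m i i (Suc m) = 0"
proof (cases "m + 2 < n")
  case True
  have "P m (Suc m) (Suc i) (m + 2) = 0" using assms True by (intro P_off) auto
  then show ?thesis using shift[of m "Suc m" i "Suc m"] assms True by simp
next
  case False
  then obtain i' where i': "i = Suc i'" using assms by (cases i) auto
  have "P i i' i' m = 0" using assms i' by (intro P_off) auto
  then have "P i m i (Suc m) = 0" using shift[of i "Suc i" i' m] assms i' by simp
  then show ?thesis using assms P_sym[of m i i "Suc m"] by simp
qed

text \<open>Collects what the linear relations leave possible outside the corner; the quadratic
  relation \<open>rep\<close> removes these families below.\<close>

lemma P_cases:
  assumes "m + 1 < n" "i + 1 < n" "a < b" "b < n" "\<not> corner a b" "P m i a b \<noteq> 0"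
  shows "m = i \<and> (a = i \<and> (b = i + 1 \<or> b + 1 = n) \<or> a = 0 \<and> b = i + 1)
    \<or> m = i + 1 \<and> a = i \<and> b = i + 2 \<or> i = m + 1 \<and> a = m \<and> b = m + 2"
proof -
  have off: "a = i \<or> b = i + 1" "a = m \<or> b = m + 1" using P_off assms by blast+
  consider "m = i" | "i < m" | "m < i" by linarith
  then show ?thesis
  proof cases
    case 1
    then consider "a = i" "b = i + 1" | "a = i" "b \<noteq> i + 1" | "a \<noteq> i" "b = i + 1" using off by auto
    then show ?thesis
    proof cases
      case 2
      then show ?thesis using P_square_row[of i b] assms 1 by fastforce
    next
      case 3
      then show ?thesis using P_square_col[of "a - 1" i] assms 1 by (cases a) fastforce+
    qed (use 1 in auto)
  next
    case 2
    then have ab: "a = i" "b = m + 1" using off assms(3) by auto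
    then have "m = i + 1" using P_distant[of i m] assms 2 by fastforce
    then show ?thesis using ab by simp
  next
    case 3
    then have ab: "a = m" "b = i + 1" using off assms(3) by auto
    have "P i m a b \<noteq> 0" using assms P_sym by simp
    then have "i = m + 1" using P_distant[of m i] assms 3 ab by fastforce
    then show ?thesis using ab by simp
  qed
qed

text \<open>From \<open>[e_i, e_(i+2)] = 0\<close> under \<open>L(e_(i+1))\<close>; the source of
  the alternating sign.\<close>

lemma P_adjacent_shift:
  assumes "i + 3 < n"
  shows "P (Suc (Suc i)) (Suc i) (Suc i) (i + 3) = - P (Suc i) i i (i + 2)"
proof -
  have "P (Suc i) (Suc (Suc i)) (Suc i) (i + 3) = - P (Suc i) i i (i + 2)"
    using shift[of "Suc i" "Suc (Suc i)" i "i + 2"] assms by (simp add: numeral_3_eq_3)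
  then show ?thesis using P_sym[of "Suc (Suc i)" "Suc i" "Suc i" "i + 3"] assms by simp
qed

section \<open>Derivations and the degree b - a\<close>

text \<open>Since \<open>E_uv = [e_u, E_(u+1,v)]\<close>, a derivation that raises the degree by at
  least d on the generators does so on every matrix unit, by induction on v - u.\<close>

lemma degree:
  assumes kl: "k < l" "l < n"
    and base: "\<And>i a b. \<lbrakk>i + 1 < n; a < b; b < n; b < a + 1 + d\<rbrakk> \<Longrightarrow> C k l i (Suc i) a b = 0"
    and "u < v" "v < n" "a < n" "b < n" "b + u < a + v + d"
  shows "C k l u v a b = 0"
  using assms(4-)
proof (induction "v - Suc u" arbitrary: u a b)
  case 0
  then have [simp]: "v = Suc u" by simp
  show ?case
  proof (cases "a < b")
    case True then show ?thesis using 0 base[of u a b] by simp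
  next
    case False then show ?thesis using 0 upper[OF kl] by simp
  qed
next
  case (Suc x)
  then have v: "Suc u < v" by simp
  have IH: "C k l (Suc u) v a' b' = 0" if "a' < n" "b' < n" "b' + Suc u < a' + v + d" for a' b'
    using Suc.hyps(2) Suc.prems v that by (intro Suc.hyps(1)) auto
  have B: "C k l u (Suc u) a' b' = 0" if "a' < n" "b' < n" "b' < a' + 1 + d" for a' b'
  proof (cases "a' < b'")
    case True then show ?thesis using that base[of u a' b'] v Suc.prems by simp
  next
    case False then show ?thesis using that upper[OF kl] v Suc.prems by simp
  qed
  show ?case
    using product_rule[OF kl lessI v Suc.prems(2-4)] Suc.prems v
    by (auto simp: IH B)
qed

lemma P_zero:
  assumes "m + 1 < n" "i + 1 < n" "a < b" "b < n" "\<not> corner a b"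
    and "\<not> (m = i \<and> (a = i \<and> (b = i + 1 \<or> b + 1 = n) \<or> a = 0 \<and> b = i + 1)
      \<or> m = i + 1 \<and> a = i \<and> b = i + 2 \<or> i = m + 1 \<and> a = m \<and> b = m + 2)"
  shows "P m i a b = 0"
  using P_cases[OF assms(1-5)] assms(6) by blast

lemma pair_sum:
  fixes f :: "nat \<Rightarrow> nat \<Rightarrow> 'a"
  assumes "S \<subseteq> {..<n} \<times> {..<n}" "\<And>u v. \<lbrakk>u < n; v < n; (u, v) \<notin> S\<rbrakk> \<Longrightarrow> f u v = 0"
  shows "(\<Sum>(u, v)\<in>{..<n} \<times> {..<n}. f u v) = (\<Sum>(u, v)\<in>S. f u v)"
  by (rule sum.mono_neutral_right) (use assms in auto)

text \<open>With d = 0 the condition on the generators is empty, strictly upper entries having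
  degree at least 1.\<close>

lemma degree_ge_0:
  assumes "m + 1 < n" "u < v" "v < n" "a < n" "b < n" "b + u < a + v"
  shows "C m (Suc m) u v a b = 0"
  by (rule degree[where d = 0]) (use assms in auto)

section \<open>Diagonal coefficients of squares\<close>

text \<open>On \<open>[e_i, e_(i+1)]\<close> the diagonal coefficients of a derivation add up;
  \<open>P_zero\<close> removes the contribution of \<open>e_(i+1)\<close> here and that of
  \<open>e_i\<close> in \<open>diagonal_right\<close>.\<close>

lemma diagonal_left:
  assumes "i + 2 < n"
  shows "C i (Suc i) i (Suc (Suc i)) i (Suc (Suc i)) = P i i i (Suc i)"
proof -
  have "P i (Suc i) (Suc i) (Suc (Suc i)) = 0"
    using assms n_ge by (intro P_zero) auto
  then show ?thesis using product_rule[of i "Suc i" i "Suc i" "Suc (Suc i)" i "Suc (Suc i)"] assms by simp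
qed

lemma diagonal_right:
  assumes "i + 2 < n"
  shows "C (Suc i) (Suc (Suc i)) i (Suc (Suc i)) i (Suc (Suc i)) = P (Suc i) (Suc i) (Suc i) (Suc (Suc i))"
proof -
  have "P (Suc i) i i (Suc i) = 0"
    using assms n_ge by (intro P_zero) auto
  then show ?thesis
    using product_rule[of "Suc i" "Suc (Suc i)" i "Suc i" "Suc (Suc i)" i "Suc (Suc i)"] assms by simp
qed

text \<open>Entry \<open>(i, i+2)\<close> of \<open>L([e_i, e_(i+1)]) e_i\<close>. By
  \<open>degree_ge_0\<close>, only intermediate entries of degree 1 or 2 can contribute.\<close>

lemma P_diagonal_down:
  assumes i: "i + 2 < n"
  shows "P i i i (Suc i) = - P i i i (Suc (Suc i)) * P (Suc i) (Suc i) (Suc i) (Suc (Suc i))"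
proof -
  let ?S = "{(i, Suc i), (i, Suc (Suc i))}"
  let ?f = "\<lambda>u v. P (Suc i) i u v * C i (Suc i) u v i (Suc (Suc i))
    - P i i u v * C (Suc i) (Suc (Suc i)) u v i (Suc (Suc i))"
  have zero: "?f u v = 0" if uv: "u < n" "v < n" "(u, v) \<notin> ?S" for u v
  proof -
    consider "v \<le> u" | "u + 2 < v" | "u < v" "v \<le> u + 2" by linarith
    then show ?thesis
    proof cases
      case 1 then show ?thesis using upper uv i by simp
    next
      case 2 then show ?thesis using degree_ge_0 uv i by simp
    next
      case 3
      have "P (Suc i) i u v = 0" using 3 uv i n_ge by (intro P_zero) auto
      moreover have "P i i u v * C (Suc i) (Suc (Suc i)) u v i (Suc (Suc i)) = 0"
      proof (cases "P i i u v = 0")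
        \<comment> \<open>In this range the only other entry of the square of \<open>e_i\<close>
          that may survive is (0, 2) for i = 1, and the outer factor maps it to nothing at the
          target.\<close>
        case False
        have "P i i u v = 0" if "\<not> (Suc u = i \<and> v = Suc i)"
          using that 3 uv i n_ge by (intro P_zero) auto
        then have uv': "Suc u = i" "v = Suc i" using False by blast+
        have "P (Suc i) u (Suc i) (Suc (Suc i)) = 0"
          using uv' i n_ge by (intro P_zero) auto
        then have "C (Suc i) (Suc (Suc i)) u v i (Suc (Suc i)) = 0"
          using product_rule[of "Suc i" "Suc (Suc i)" u i v i "Suc (Suc i)"] uv' i by auto
        then show ?thesis by simp
      qed simp
      ultimately show ?thesis by simp
    qed
  qed
  have "P (Suc i) i i (Suc i) = 0"
    using i n_ge by (intro P_zero) auto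
  \<comment> \<open>The product of \<open>P i i i (Suc i)\<close> and
    \<open>P (Suc i) i i (Suc (Suc i))\<close> occurs twice with opposite signs and cancels.\<close>
  then have total: "(\<Sum>(u, v)\<in>?S. ?f u v) = - P i i i (Suc (Suc i)) * P (Suc i) (Suc i) (Suc i) (Suc (Suc i))"
    by (simp add: diagonal_left[OF i] diagonal_right[OF i] algebra_simps)
  have expand: "C i (Suc (Suc i)) i (Suc i) i (Suc (Suc i)) = (\<Sum>(u, v)\<in>?S. ?f u v)"
    using rep[of i "Suc i" i "Suc i" "Suc (Suc i)" i "Suc (Suc i)"] i
    by (subst pair_sum[OF _ zero, symmetric]) auto
  have lhs: "C i (Suc (Suc i)) i (Suc i) i (Suc (Suc i)) = P i i i (Suc i)"
    using swap[of i "Suc (Suc i)" i "Suc i" i "Suc (Suc i)"] diagonal_left[OF i] i by simp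
  show ?thesis by (rule trans[OF lhs[symmetric] trans[OF expand total]])
qed

text \<open>The counterpart for \<open>L([e_i, e_(i+1)]) e_(i+1)\<close>: each diagonal coefficient
  is a multiple of the preceding one.\<close>

lemma P_diagonal_up:
  assumes i: "i + 2 < n"
  shows "P (Suc i) (Suc i) (Suc i) (Suc (Suc i)) = P (Suc i) (Suc i) i (Suc (Suc i)) * P i i i (Suc i)"
proof -
  let ?S = "{(Suc i, Suc (Suc i)), (i, Suc (Suc i))}"
  let ?f = "\<lambda>u v. P (Suc i) (Suc i) u v * C i (Suc i) u v i (Suc (Suc i))
    - P i (Suc i) u v * C (Suc i) (Suc (Suc i)) u v i (Suc (Suc i))"
  have zero: "?f u v = 0" if uv: "u < n" "v < n" "(u, v) \<notin> ?S" for u v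
  proof -
    consider "v \<le> u" | "u + 2 < v" | "u < v" "v \<le> u + 2" by linarith
    then show ?thesis
    proof cases
      case 1 then show ?thesis using upper uv i by simp
    next
      case 2 then show ?thesis using degree_ge_0 uv i by simp
    next
      case 3
      have "P i (Suc i) u v = 0" using 3 uv i n_ge by (intro P_zero) auto
      moreover have "P (Suc i) (Suc i) u v * C i (Suc i) u v i (Suc (Suc i)) = 0"
      proof (cases "P (Suc i) (Suc i) u v = 0")
        case False
        have "P (Suc i) (Suc i) u v = 0" if "\<not> (u = Suc i \<and> v = Suc (Suc (Suc i)))"
          using that 3 uv i n_ge by (intro P_zero) auto
        then have uv': "u = Suc i" "v = Suc (Suc (Suc i))" using False by blast+
        have "P i (Suc (Suc i)) i (Suc i) = 0"
          using uv uv' i n_ge by (intro P_zero) auto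
        then have "C i (Suc i) u v i (Suc (Suc i)) = 0"
          using product_rule[of i "Suc i" "Suc i" "Suc (Suc i)" v i "Suc (Suc i)"] uv uv' i by auto
        then show ?thesis by simp
      qed simp
      ultimately show ?thesis by simp
    qed
  qed
  have "P i (Suc i) (Suc i) (Suc (Suc i)) = 0"
    using i n_ge by (intro P_zero) auto
  then have total: "(\<Sum>(u, v)\<in>?S. ?f u v) = P (Suc i) (Suc i) i (Suc (Suc i)) * P i i i (Suc i)"
    by (simp add: diagonal_left[OF i] diagonal_right[OF i] algebra_simps)
  have expand: "C i (Suc (Suc i)) (Suc i) (Suc (Suc i)) i (Suc (Suc i)) = (\<Sum>(u, v)\<in>?S. ?f u v)"
    using rep[of "Suc i" "Suc (Suc i)" i "Suc i" "Suc (Suc i)" i "Suc (Suc i)"] i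
    by (subst pair_sum[OF _ zero, symmetric]) auto
  have lhs: "C i (Suc (Suc i)) (Suc i) (Suc (Suc i)) i (Suc (Suc i))
      = P (Suc i) (Suc i) (Suc i) (Suc (Suc i))"
    using swap[of i "Suc (Suc i)" "Suc i" "Suc (Suc i)" i "Suc (Suc i)"] diagonal_right[OF i] i by simp
  show ?thesis by (rule trans[OF lhs[symmetric] trans[OF expand total]])
qed

lemma P_diagonal: "i + 1 < n \<Longrightarrow> P i i i (Suc i) = 0"
proof (induction i)
  case 0
  \<comment> \<open>Position (0, 2) lies outside the corner because n \<ge> 5; the factor in
    \<open>P_diagonal_down\<close> is then zero.\<close>
  have "P 0 0 0 2 = 0" using n_ge by (intro P_square_row) auto
  then show ?case using P_diagonal_down[of 0] n_ge by (simp add: numeral_2_eq_2)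
next
  case (Suc i)
  then show ?case using P_diagonal_up[of i] by simp
qed

lemma P_degree:
  assumes "m + 1 < n" "i + 1 < n" "a < n" "b < n" "b \<le> a + 1"
  shows "P m i a b = 0"
proof (cases "a < b")
  case True
  then have "b = Suc a" using assms by simp
  show ?thesis
  proof (cases "m = i \<and> a = i")
    case True
    then show ?thesis using P_diagonal \<open>b = Suc a\<close> assms by simp
  next
    case False
    then show ?thesis using \<open>b = Suc a\<close> assms n_ge by (intro P_zero) auto
  qed
next
  case False
  then show ?thesis using upper assms by simp
qed

text \<open>\<open>P_degree\<close> has removed degree 1 from products of generators, so
  \<open>L(e_m)\<close> strictly raises the degree.\<close>

lemma degree_ge_1:
  assumes "m + 1 < n" "u < v" "v < n" "a < n" "b < n" "b + u \<le> a + v"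
  shows "C m (Suc m) u v a b = 0"
  by (rule degree[where d = 1]) (use assms in \<open>auto intro: P_degree\<close>)

section \<open>Products of neighbouring generators\<close>

text \<open>Entry \<open>(i, i+3)\<close> of \<open>L([e_i, e_(i+1)]) e_(i+2)\<close>. Intermediate
  entries of degree above 2 are raised past the target, and below that only
  \<open>(i+1, i+3)\<close> contributes.\<close>

lemma P_adjacent_mult:
  assumes i: "i + 3 < n"
  shows "P (Suc (Suc i)) (Suc i) (Suc i) (i + 3) = P (Suc (Suc i)) (Suc i) (Suc i) (i + 3) * P (Suc i) i i (i + 2)"
proof -
  let ?S = "{(Suc i, i + 3)}"
  let ?f = "\<lambda>u v. P (Suc i) (Suc (Suc i)) u v * C i (Suc i) u v i (i + 3)
    - P i (Suc (Suc i)) u v * C (Suc i) (Suc (Suc i)) u v i (i + 3)"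
  have P0: "P i (Suc (Suc i)) u v = 0" if "u < n" "v < n" "u < v" "v \<le> u + 2" for u v
    using that i n_ge by (intro P_zero) auto
  have zero: "?f u v = 0" if uv: "u < n" "v < n" "(u, v) \<notin> ?S" for u v
  proof -
    consider "v \<le> u" | "u + 2 < v" | "u < v" "v \<le> u + 2" by linarith
    then show ?thesis
    proof cases
      case 1 then show ?thesis using upper uv i by simp
    next
      case 2 then show ?thesis using degree_ge_1 uv i by simp
    next
      case 3
      have "P (Suc i) (Suc (Suc i)) u v = 0"
        using 3 uv i n_ge by (intro P_zero) auto
      then show ?thesis using P0 3 uv by simp
    qed
  qed
  have "C i (Suc i) (Suc i) (i + 3) i (i + 3) = P i (Suc i) i (i + 2)"
    using product_rule[of i "Suc i" "Suc i" "i + 2" "i + 3" i "i + 3"] i by simp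
  then have total: "(\<Sum>(u, v)\<in>?S. ?f u v) = P (Suc (Suc i)) (Suc i) (Suc i) (i + 3) * P (Suc i) i i (i + 2)"
    using P0[of "Suc i" "i + 3"] P_sym[of i "Suc i" i "i + 2"]
      P_sym[of "Suc i" "Suc (Suc i)" "Suc i" "i + 3"] i by simp
  have expand: "C i (Suc (Suc i)) (Suc (Suc i)) (Suc (Suc (Suc i))) i (i + 3) = (\<Sum>(u, v)\<in>?S. ?f u v)"
    using rep[of "Suc (Suc i)" "Suc (Suc (Suc i))" i "Suc i" "Suc (Suc i)" i "i + 3"] i
    by (subst pair_sum[OF _ zero, symmetric]) auto
  have lhs1: "C i (Suc (Suc i)) (Suc (Suc i)) (Suc (Suc (Suc i))) i (i + 3)
      = C (Suc (Suc i)) (Suc (Suc (Suc i))) i (Suc (Suc i)) i (i + 3)"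
    using i by (intro swap) auto
  have lhs2: "C (Suc (Suc i)) (Suc (Suc (Suc i))) i (Suc (Suc i)) i (i + 3)
      = P (Suc (Suc i)) (Suc i) (Suc i) (i + 3)"
    using product_rule[of "Suc (Suc i)" "Suc (Suc (Suc i))" i "Suc i" "Suc (Suc i)" i "i + 3"] i by simp
  show ?thesis by (rule trans[OF trans[OF lhs1 lhs2, symmetric] trans[OF expand total]])
qed

lemma P_adjacent: "i + 2 < n \<Longrightarrow> P (Suc i) i i (i + 2) = 0"
proof (induction i)
  case 0
  \<comment> \<open>The first three adjacent coefficients are c, -c, c, and the last two equal
    themselves times their predecessors. So c = c * c and c = -(c * c). The third one involves
    \<open>e_3\<close>, hence n \<ge> 5.\<close>
  define c where "c = P 1 0 0 2"
  have "P 2 1 1 3 = - c" using P_adjacent_shift[of 0] n_ge by (simp add: c_def numeral_2_eq_2)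
  moreover have "P 3 2 2 4 = - P 2 1 1 3"
    using P_adjacent_shift[of 1] n_ge by (simp add: eval_nat_numeral)
  moreover have "P 2 1 1 3 = P 2 1 1 3 * c"
    using P_adjacent_mult[of 0] n_ge by (simp add: c_def numeral_2_eq_2)
  moreover have "P 3 2 2 4 = P 3 2 2 4 * P 2 1 1 3"
    using P_adjacent_mult[of 1] n_ge by (simp add: eval_nat_numeral)
  ultimately have "c = c * c" "c = - (c * c)" by auto
  then have "2 * c = 0" by (metis add.right_inverse mult_2)
  then show ?case by (simp add: c_def numeral_2_eq_2)
next
  case (Suc i)
  then show ?case using P_adjacent_shift[of i] by (simp add: numeral_3_eq_3)
qed

section \<open>Last column and first row of squares\<close>

text \<open>Entry \<open>(j, n-1)\<close> of \<open>L([e_j, e_(j+1)]) e_(j+1)\<close>: the left side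
  is the coefficient sought, and every summand on the right vanishes. Corner entries are raised past
  the target degree n - 1 - j, which is at most n - 2 as j > 0.\<close>

lemma P_last_column:
  assumes j: "0 < j" "j + 3 < n"
  shows "P (Suc j) (Suc j) (Suc j) (n - 1) = 0"
proof -
  let ?f = "\<lambda>u v. P (Suc j) (Suc j) u v * C j (Suc j) u v j (n - 1)
    - P j (Suc j) u v * C (Suc j) (Suc (Suc j)) u v j (n - 1)"
  have zero: "?f u v = 0" if uv: "u < n" "v < n" for u v
  proof -
    consider "v \<le> u" | "corner u v" | "u < v" "\<not> corner u v" by linarith
    then show ?thesis
    proof cases
      case 1 then show ?thesis using upper uv j by simp
    next
      case 2 then show ?thesis using degree_ge_1 uv j by simp
    next
      case 3
      have "P j (Suc j) u v = 0"
      proof (rule ccontr)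
        assume *: "P j (Suc j) u v \<noteq> 0"
        have "P j (Suc j) u v = 0" if "\<not> (u = j \<and> v = j + 2)"
          using that 3 uv j n_ge by (intro P_zero) auto
        then have "u = j" "v = j + 2" using * by blast+
        then show False using * P_adjacent[of j] P_sym[of j "Suc j" j "j + 2"] j by simp
      qed
      moreover have "P (Suc j) (Suc j) u v * C j (Suc j) u v j (n - 1) = 0"
      proof (cases "P (Suc j) (Suc j) u v = 0")
        case False
        have "\<not> (u = Suc j \<and> v = Suc (Suc j))" using False P_diagonal[of "Suc j"] j by auto
        then have "P (Suc j) (Suc j) u v = 0"
          if "\<not> (u = Suc j \<and> v = n - 1)" "\<not> (u = 0 \<and> v = j + 2)"
          using that 3 uv j n_ge by (intro P_zero) auto
        then consider "u = Suc j" "v = n - 1" | "u = 0" "v = j + 2" using False by blast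
        then show ?thesis
        proof cases
          case 1
          have "C j (Suc j) u v j (n - 1) = P j (Suc j) j (j + 2)"
            using product_rule[of j "Suc j" "Suc j" "j + 2" v j "n - 1"] 1 j by auto
          then show ?thesis using P_adjacent[of j] P_sym[of j "Suc j" j "j + 2"] j by simp
        next
          case 2
          \<comment> \<open>In \<open>[e_0, E_(1,j+2)]\<close> only the image of \<open>e_0\<close>
            can reach the target, and only for j = 1.\<close>
          have "P j 0 (j + 2) (n - 1) = 0" if "j = 1"
            using j that by (intro P_zero) auto
          then have "C j (Suc j) u v j (n - 1) = 0"
            using product_rule[of j "Suc j" 0 1 v j "n - 1"] 2 j by auto
          then show ?thesis by simp
        qed
      qed simp
      ultimately show ?thesis by simp
    qed
  qed
  have expand: "C j (Suc (Suc j)) (Suc j) (Suc (Suc j)) j (n - 1) = (\<Sum>(u, v)\<in>{}. ?f u v)"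
    using rep[of "Suc j" "Suc (Suc j)" j "Suc j" "Suc (Suc j)" j "n - 1"] j
    by (subst pair_sum[OF _ zero, symmetric]) auto
  have lhs1: "C j (Suc (Suc j)) (Suc j) (Suc (Suc j)) j (n - 1)
      = C (Suc j) (Suc (Suc j)) j (Suc (Suc j)) j (n - 1)"
    using j by (intro swap) auto
  have lhs2: "C (Suc j) (Suc (Suc j)) j (Suc (Suc j)) j (n - 1) = P (Suc j) (Suc j) (Suc j) (n - 1)"
    using product_rule[of "Suc j" "Suc (Suc j)" j "Suc j" "Suc (Suc j)" j "n - 1"] j by auto
  show ?thesis by (rule trans[OF trans[OF lhs1 lhs2, symmetric] trans[OF expand sum.empty]])
qed

lemma P_first_row:
  assumes i: "0 < i" "i + 3 < n"
  shows "P i i 0 (Suc i) = 0"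
proof -
  interpret M: cpa_constants n "\<lambda>k l a b i j. - C (opp l) (opp k) (opp b) (opp a) (opp j) (opp i)"
    by (rule mirror)
  \<comment> \<open>The reflection carries \<open>e_(j+1)\<close> to \<open>-e_i\<close> and
    position \<open>(j+1, n-1)\<close> to \<open>(0, i+1)\<close>.\<close>
  obtain j where j: "j = n - 3 - i" "0 < j" "j + 3 < n" using i by auto
  have "opp (Suc j) = Suc i" "opp (Suc (Suc j)) = i" "opp (n - 1) = 0"
    using i j by (simp_all add: opp_def)
  then show ?thesis using M.P_last_column[OF j(2,3)] by simp
qed

section \<open>Degree bounds for all products\<close>

lemma P_corner:
  assumes "m + 1 < n" "i + 1 < n" "a < n" "b < n" "\<not> corner a b"
  shows "P m i a b = 0"
proof (rule ccontr)
  assume nz: "P m i a b \<noteq> 0"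
  then have "\<not> b \<le> a + 1" using P_degree assms by blast
  then consider "m = i" "a = i" "b = n - 1" | "m = i" "a = 0" "b = Suc i"
    | "m = i + 1" "a = i" "b = i + 2" | "i = m + 1" "a = m" "b = m + 2"
    using P_cases[OF assms(1,2) _ assms(4,5) nz] by auto
  then show False
  proof cases
    case 1
    then show False using P_last_column[of "i - 1"] nz assms \<open>\<not> b \<le> a + 1\<close> by force
  next
    case 2
    then show False using P_first_row[of i] nz assms \<open>\<not> b \<le> a + 1\<close> by force
  next
    case 3
    then show False using P_adjacent[of i] nz assms by simp
  next
    case 4
    then show False using P_adjacent[of m] P_sym[of m "Suc m" m "m + 2"] nz assms by simp
  qed
qed

text \<open>\<open>degree\<close> applies twice, with commutativity in between. By
  \<open>P_corner\<close>, \<open>L(e_i)\<close> raises degrees by n - 3, so the product of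
  \<open>e_i\<close> and \<open>E_kl\<close> has degree at least l - k + n - 3; hence
  \<open>L(E_kl)\<close> raises degrees by l - k + n - 4.\<close>

lemma degree_bound:
  assumes "k < l" "l < n" "u < v" "v < n" "a < n" "b < n" "b + u < a + v + (l - k + n - 4)"
  shows "C k l u v a b = 0"
proof (rule degree[where d = "l - k + n - 4"])
  fix i a b assume i: "i + 1 < n" "a < b" "b < n" "b < a + 1 + (l - k + n - 4)"
  have "C i (Suc i) k l a b = 0"
  proof (rule degree[where d = "n - 3"])
    show "C i (Suc i) i' (Suc i') a' b' = 0"
      if "i' + 1 < n" "a' < b'" "b' < n" "b' < a' + 1 + (n - 3)" for i' a' b'
      using that i n_ge by (intro P_corner) auto
  qed (use assms i n_ge in auto)
  then show "C k l i (Suc i) a b = 0" using swap[of k l i "Suc i" a b] assms i by simp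
qed (use assms in auto)

lemma product_corner:
  assumes "k < l" "l < n" "u < v" "v < n" "a < n" "b < n" "\<not> corner a b"
  shows "C k l u v a b = 0"
  by (rule degree_bound) (use assms n_ge in auto)

text \<open>\<open>rep\<close> for \<open>E_kl = [e_k, E_(k+1,l)]\<close>: inner products have
  degree at least n - 2, and the outer factor lifts them to at least 2n - 5 \<ge> n, past the last
  entry.\<close>

lemma product_commutator:
  assumes "k + 2 \<le> l" "l < n" "u < v" "v < n" "a < n" "b < n"
  shows "C k l u v a b = 0"
proof -
  have zero: "C (Suc k) l u v r s * C k (Suc k) r s a b - C k (Suc k) u v r s * C (Suc k) l r s a b = 0"
    if rs: "r < n" "s < n" for r s
  proof -
    consider "s \<le> r" | "r < s" "\<not> corner r s" | "r < s" "corner r s" by linarith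
    then show ?thesis
    proof cases
      case 1 then show ?thesis using upper rs assms by simp
    next
      case 2 then show ?thesis using product_corner rs assms by simp
    next
      case 3
      have "C k (Suc k) r s a b = 0" "C (Suc k) l r s a b = 0"
        using 3 rs assms n_ge by (auto intro!: degree_bound)
      then show ?thesis by simp
    qed
  qed
  have "C k l u v a b = (\<Sum>(r, s)\<in>{}.
      C (Suc k) l u v r s * C k (Suc k) r s a b - C k (Suc k) u v r s * C (Suc k) l r s a b)"
    using rep[of u v k "Suc k" l a b] assms by (subst pair_sum[OF _ zero, symmetric]) auto
  then show ?thesis by (simp only: sum.empty)
qed

end


section \<open>Transfer to matrices\<close>

definition elem_mat :: "nat \<Rightarrow> nat \<Rightarrow> nat \<Rightarrow> 'a :: field mat"
  where "elem_mat n a b = mat n n (\<lambda>(i, j). if i = a \<and> j = b then 1 else 0)"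

lemma elem_mat_carrier: "elem_mat n a b \<in> carrier_mat n n"
  by (simp add: elem_mat_def)

lemma elem_mat_dim [simp]: "dim_row (elem_mat n a b) = n" "dim_col (elem_mat n a b) = n"
  by (simp_all add: elem_mat_def)

lemma square_mat_eqI:
  assumes "A \<in> carrier_mat n n" "B \<in> carrier_mat n n"
    and "\<And>i j. \<lbrakk>i < n; j < n\<rbrakk> \<Longrightarrow> A $$ (i, j) = B $$ (i, j)"
  shows "A = B"
  using assms by (intro eq_matI) auto

lemma elem_mat_index: "i < n \<Longrightarrow> j < n \<Longrightarrow> elem_mat n a b $$ (i, j) = (if i = a \<and> j = b then 1 else 0)"
  by (simp add: elem_mat_def)

lemma elem_mat_strict_upper: "a < b \<Longrightarrow> elem_mat n a b \<in> carrier (strict_upper TYPE('a :: field) n)"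
  by (auto simp: strict_upper_simps elem_mat_def)

lemma elem_mat_mult_left:
  assumes "X \<in> carrier_mat n n" "b < n" "i < n" "j < n"
  shows "(elem_mat n a b * X) $$ (i, j) = (if i = a then X $$ (b, j) else 0)"
proof -
  have "(elem_mat n a b * X) $$ (i, j) = (\<Sum>k = 0..<n. if k = b then (if i = a then X $$ (b, j) else 0) else 0)"
    using assms by (auto simp: elem_mat_index scalar_prod_def simp del: sum.delta intro!: sum.cong)
  then show ?thesis using assms by simp
qed

lemma elem_mat_mult_right:
  assumes "X \<in> carrier_mat n n" "a < n" "i < n" "j < n"
  shows "(X * elem_mat n a b) $$ (i, j) = (if j = b then X $$ (i, a) else 0)"
proof -
  have "(X * elem_mat n a b) $$ (i, j) = (\<Sum>k = 0..<n. if k = a then (if j = b then X $$ (i, a) else 0) else 0)"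
    using assms by (auto simp: elem_mat_index scalar_prod_def simp del: sum.delta intro!: sum.cong)
  then show ?thesis using assms by simp
qed

lemma commutator_index:
  assumes "X \<in> carrier_mat n n" "Y \<in> carrier_mat n n" "i < n" "j < n"
  shows "mat_commutator X Y $$ (i, j) = (X * Y) $$ (i, j) - (Y * X) $$ (i, j)"
  using assms unfolding mat_commutator_def by (intro index_minus_mat(1)) auto

lemma commutator_elem_mat_left:
  assumes "X \<in> carrier_mat n n" "a < n" "b < n" "i < n" "j < n"
  shows "mat_commutator (elem_mat n a b) X $$ (i, j)
    = (if i = a then X $$ (b, j) else 0) - (if j = b then X $$ (i, a) else 0)"
  unfolding commutator_index[OF elem_mat_carrier assms(1,4,5)] commutator_index[OF assms(1) elem_mat_carrier assms(4,5)]
    elem_mat_mult_left[OF assms(1,3,4,5)] elem_mat_mult_right[OF assms(1,2,4,5)] ..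

lemma commutator_elem_mat_right:
  assumes "X \<in> carrier_mat n n" "a < n" "b < n" "i < n" "j < n"
  shows "mat_commutator X (elem_mat n a b) $$ (i, j)
    = (if j = b then X $$ (i, a) else 0) - (if i = a then X $$ (b, j) else 0)"
  unfolding commutator_index[OF elem_mat_carrier assms(1,4,5)] commutator_index[OF assms(1) elem_mat_carrier assms(4,5)]
    elem_mat_mult_left[OF assms(1,3,4,5)] elem_mat_mult_right[OF assms(1,2,4,5)] ..

lemma commutator_carrier:
  "X \<in> carrier_mat n n \<Longrightarrow> Y \<in> carrier_mat n n \<Longrightarrow> mat_commutator X Y \<in> carrier_mat n n"
  unfolding mat_commutator_def by (meson minus_carrier_mat mult_carrier_mat)

lemma commutator_elem_mats:
  assumes "a < b" "b < d" "d < n"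
  shows "mat_commutator (elem_mat n a b) (elem_mat n b d) = elem_mat n a d"
  by (rule square_mat_eqI)
    (use assms in \<open>auto intro!: commutator_carrier elem_mat_carrier
      simp: commutator_elem_mat_left elem_mat_carrier elem_mat_index\<close>)

lemma commutator_elem_mats_zero:
  assumes "a < b" "b < n" "c < d" "d < n" "b \<noteq> c" "d \<noteq> a"
  shows "mat_commutator (elem_mat n a b) (elem_mat n c d) = 0\<^sub>m n n"
  by (rule square_mat_eqI)
    (use assms in \<open>auto intro!: commutator_carrier elem_mat_carrier
      simp: commutator_elem_mat_left elem_mat_carrier elem_mat_index\<close>)

text \<open>The difference in the record rests on the abstract additive inverse, which uniqueness of
  inverses identifies with matrix negation.\<close>

lemma strict_upper_minus:
  assumes "A \<in> carrier (strict_upper TYPE('a :: field) n)" "B \<in> carrier (strict_upper TYPE('a) n)"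
  shows "A \<ominus>\<^bsub>strict_upper TYPE('a) n\<^esub> B = A - B"
proof -
  interpret V: vectorspace "class_ring :: 'a ring" "strict_upper TYPE('a) n"
    by (rule strict_upper_vectorspace)
  have mB: "- B \<in> carrier (strict_upper TYPE('a) n)"
    using assms(2) by (auto simp: strict_upper_simps)
  have "- B \<oplus>\<^bsub>strict_upper TYPE('a) n\<^esub> B = \<zero>\<^bsub>strict_upper TYPE('a) n\<^esub>"
    using assms(2) by (auto simp: strict_upper_simps)
  then have "\<ominus>\<^bsub>strict_upper TYPE('a) n\<^esub> B = - B"
    using V.minus_equality assms(2) mB by blast
  then show ?thesis
    using assms by (auto simp: a_minus_def strict_upper_simps)
qed

text \<open>Linear induction over matrix units. The last case retains that the original matrix is
  nonzero at the unit's position, so support conditions pass to the units.\<close>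

lemma strict_upper_induct [consumes 1, case_names zero add smult elem]:
  fixes A :: "'a :: field mat"
  assumes A: "A \<in> carrier (strict_upper TYPE('a) n)"
    and zero: "Q (0\<^sub>m n n)"
    and add: "\<And>A B. \<lbrakk>A \<in> carrier (strict_upper TYPE('a) n); B \<in> carrier (strict_upper TYPE('a) n); Q A; Q B\<rbrakk>
      \<Longrightarrow> Q (A + B)"
    and smult: "\<And>c A. \<lbrakk>A \<in> carrier (strict_upper TYPE('a) n); Q A\<rbrakk> \<Longrightarrow> Q (c \<cdot>\<^sub>m A)"
    and elem: "\<And>a b. \<lbrakk>a < b; b < n; A $$ (a, b) \<noteq> 0\<rbrakk> \<Longrightarrow> Q (elem_mat n a b)"
  shows "Q A"
proof -
  \<comment> \<open>S contains the support of B and lies in the support of A; in the induction,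
    \<open>B'\<close> clears the entry of B at the removed position.\<close>
  have "Q B" if "finite S" "B \<in> carrier (strict_upper TYPE('a) n)"
    "\<forall>a<n. \<forall>b<n. (a, b) \<notin> S \<longrightarrow> B $$ (a, b) = 0"
    "\<forall>a b. (a, b) \<in> S \<longrightarrow> a < b \<and> b < n \<and> A $$ (a, b) \<noteq> 0" for S B
    using that
  proof (induction S arbitrary: B rule: finite_induct)
    case empty
    then have "B = 0\<^sub>m n n" by (intro eq_matI) (auto simp: strict_upper_simps)
    then show ?case using zero by simp
  next
    case (insert s S)
    obtain a b where s: "s = (a, b)" by (cases s)
    then have ab: "a < b" "b < n" "A $$ (a, b) \<noteq> 0" using insert.prems(3) by auto
    let ?E = "elem_mat n a b :: 'a mat"
    have E: "?E \<in> carrier (strict_upper TYPE('a) n)" by (rule elem_mat_strict_upper) (rule ab(1))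
    let ?c = "B $$ (a, b)"
    define B' where "B' = B + (- ?c) \<cdot>\<^sub>m ?E"
    have B': "B' \<in> carrier (strict_upper TYPE('a) n)"
      using insert.prems(1) E by (auto simp: strict_upper_simps B'_def)
    have "B' $$ (i, j) = 0" if "i < n" "j < n" "(i, j) \<notin> S" for i j
      using that insert.prems(1,2) E by (auto simp: B'_def s elem_mat_index strict_upper_simps)
    then have "Q B'" using insert.IH[OF B'] insert.prems(3) by auto
    moreover have "?c \<cdot>\<^sub>m ?E \<in> carrier (strict_upper TYPE('a) n)"
      using E by (auto simp: strict_upper_simps)
    moreover have "Q (?c \<cdot>\<^sub>m ?E)" using smult[OF E elem[OF ab]] .
    ultimately have "Q (B' + ?c \<cdot>\<^sub>m ?E)" using B' add by blast
    moreover have "B' + ?c \<cdot>\<^sub>m ?E = B"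
      using insert.prems(1) E by (intro eq_matI) (auto simp: B'_def strict_upper_simps)
    ultimately show ?case by simp
  qed
  note * = this
  have "finite {(a, b). a < n \<and> b < n \<and> A $$ (a, b) \<noteq> 0}"
    by (rule finite_subset[of _ "{..<n} \<times> {..<n}"]) auto
  moreover have "a < b" if "a < n" "b < n" "A $$ (a, b) \<noteq> 0" for a b
    using A that by (auto simp: strict_upper_simps not_less[symmetric])
  ultimately show ?thesis using A by (intro *) auto
qed

section \<open>Coordinates of a CPA-product on matrices\<close>

context
  fixes n :: nat and p :: "'a :: field_char_0 mat \<Rightarrow> 'a mat \<Rightarrow> 'a mat"
  assumes n_ge: "n \<ge> 5"
    and cpa: "cpa_structure class_ring (strict_upper TYPE('a) n) mat_commutator p"
begin

interpretation cpa_structure class_ring "strict_upper TYPE('a) n" mat_commutator p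
  by (rule cpa)

abbreviation E :: "nat \<Rightarrow> nat \<Rightarrow> 'a mat"
  where "E \<equiv> elem_mat n"

lemmas E_strict_upper = elem_mat_strict_upper[where 'a = 'a, of _ _ n]

lemma strict_upper_carrier_mat: "A \<in> carrier (strict_upper TYPE('a) n) \<Longrightarrow> A \<in> carrier_mat n n"
  by (simp add: strict_upper_simps)

lemma strict_upper_zero: "0\<^sub>m n n \<in> carrier (strict_upper TYPE('a) n)"
  by (auto simp: strict_upper_simps)

lemma product_zero:
  assumes "x \<in> carrier (strict_upper TYPE('a) n)"
  shows "p x (0\<^sub>m n n) = 0\<^sub>m n n"
proof -
  have "p x (0 \<cdot>\<^sub>m 0\<^sub>m n n) = 0 \<cdot>\<^sub>m p x (0\<^sub>m n n)"
    using cpa.p_smult_right[of 0 x "0\<^sub>m n n"] assms strict_upper_zero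
    by (simp add: strict_upper_simps class_ring_simps)
  moreover have "p x (0\<^sub>m n n) \<in> carrier_mat n n"
    using cpa.p_closed[OF assms strict_upper_zero] by (rule strict_upper_carrier_mat)
  then have "0 \<cdot>\<^sub>m p x (0\<^sub>m n n) = 0\<^sub>m n n" by (intro square_mat_eqI) auto
  ultimately show ?thesis by simp
qed

lemma product_add:
  assumes "x \<in> carrier (strict_upper TYPE('a) n)" "A \<in> carrier (strict_upper TYPE('a) n)"
    "B \<in> carrier (strict_upper TYPE('a) n)"
  shows "p x (A + B) = p x A + p x B"
  using cpa.p_add_right[OF assms] by (simp add: strict_upper_simps)

lemma product_smult:
  assumes "x \<in> carrier (strict_upper TYPE('a) n)" "A \<in> carrier (strict_upper TYPE('a) n)"
  shows "p x (c \<cdot>\<^sub>m A) = c \<cdot>\<^sub>m p x A"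
  using cpa.p_smult_right[OF _ assms, of c] by (simp add: strict_upper_simps class_ring_simps)

lemma product_carrier:
  assumes "x \<in> carrier (strict_upper TYPE('a) n)" "A \<in> carrier (strict_upper TYPE('a) n)"
  shows "p x A \<in> carrier_mat n n"
  using cpa.p_closed[OF assms] by (rule strict_upper_carrier_mat)

text \<open>Linearity in the second factor; on nested products it yields the sum over intermediate
  positions in \<open>rep\<close>.\<close>

lemma product_expand:
  assumes x: "x \<in> carrier (strict_upper TYPE('a) n)" and A: "A \<in> carrier (strict_upper TYPE('a) n)"
    and ij: "i < n" "j < n"
  shows "p x A $$ (i, j) = (\<Sum>(u, v)\<in>{..<n} \<times> {..<n}. A $$ (u, v) * p x (E u v) $$ (i, j))"
  using A
proof (induction rule: strict_upper_induct)
  case zero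
  have "(\<Sum>(u, v)\<in>{..<n} \<times> {..<n}. 0\<^sub>m n n $$ (u, v) * p x (E u v) $$ (i, j)) = 0"
    by (rule sum.neutral) auto
  then show ?case using product_zero[OF x] ij by simp
next
  case (add A B)
  have "p x (A + B) $$ (i, j) = p x A $$ (i, j) + p x B $$ (i, j)"
    using product_add[OF x add(1,2)] product_carrier[OF x] add(1,2) ij
    by (metis carrier_matD index_add_mat(1))
  also have "\<dots> = (\<Sum>(u, v)\<in>{..<n} \<times> {..<n}. (A + B) $$ (u, v) * p x (E u v) $$ (i, j))"
    unfolding add sum.distrib[symmetric]
    by (rule sum.cong) (use strict_upper_carrier_mat[OF add(2)] in \<open>auto simp: distrib_right\<close>)
  finally show ?case .
next
  case (smult c A)
  have "p x (c \<cdot>\<^sub>m A) $$ (i, j) = c * p x A $$ (i, j)"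
    using product_smult[OF x smult(1)] product_carrier[OF x smult(1)] ij
    by (metis carrier_matD index_smult_mat(1))
  also have "\<dots> = (\<Sum>(u, v)\<in>{..<n} \<times> {..<n}. (c \<cdot>\<^sub>m A) $$ (u, v) * p x (E u v) $$ (i, j))"
    unfolding smult sum_distrib_left
    by (rule sum.cong) (use strict_upper_carrier_mat[OF smult(1)] in \<open>auto simp: mult.assoc\<close>)
  finally show ?case .
next
  case (elem a b)
  have "(\<Sum>(u, v)\<in>{..<n} \<times> {..<n}. E a b $$ (u, v) * p x (E u v) $$ (i, j))
      = (\<Sum>(u, v)\<in>{(a, b)}. E a b $$ (u, v) * p x (E u v) $$ (i, j))"
    using elem by (intro sum.mono_neutral_right) (auto simp: elem_mat_index split: if_splits)
  then show ?case using elem by (simp add: elem_mat_index)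
qed

lemma derivation_index:
  assumes "x \<in> carrier (strict_upper TYPE('a) n)" "a < b" "b < n" "c < d" "d < n" "i < n" "j < n"
  shows "p x (mat_commutator (E a b) (E c d)) $$ (i, j)
    = (if j = d then p x (E a b) $$ (i, c) else 0) - (if i = c then p x (E a b) $$ (d, j) else 0)
      + (if i = a then p x (E c d) $$ (b, j) else 0) - (if j = b then p x (E c d) $$ (i, a) else 0)"
proof -
  let ?y = "mat_commutator (p x (E a b)) (E c d)" and ?z = "mat_commutator (E a b) (p x (E c d))"
  have E: "E a b \<in> carrier (strict_upper TYPE('a) n)" "E c d \<in> carrier (strict_upper TYPE('a) n)"
    using assms E_strict_upper by auto
  have pE: "p x (E a b) \<in> carrier_mat n n" "p x (E c d) \<in> carrier_mat n n"
    using E product_carrier assms(1) by auto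
  have z: "?z \<in> carrier_mat n n" using pE by (intro commutator_carrier elem_mat_carrier)
  have "p x (mat_commutator (E a b) (E c d)) = ?y + ?z"
    using cpa_derivation[OF assms(1) E] by (simp add: strict_upper_simps)
  then have "p x (mat_commutator (E a b) (E c d)) $$ (i, j) = ?y $$ (i, j) + ?z $$ (i, j)"
    using z assms(6,7) by simp
  then show ?thesis
    using assms pE by (simp add: commutator_elem_mat_left commutator_elem_mat_right)
qed

text \<open>\<open>product_rule\<close> and \<open>commute\<close> are the derivation identity on
  brackets of matrix units; \<open>rep\<close> is the identity for \<open>L([x, y])\<close> in
  coordinates.\<close>

lemma strict_upper_constants: "cpa_constants n (\<lambda>k l a b i j. p (E k l) (E a b) $$ (i, j))"
proof (unfold_locales, goal_cases)
  case 1
  show ?case by (rule n_ge)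
next
  case (2 k l a b i j)
  then have "p (E k l) (E a b) \<in> carrier (strict_upper TYPE('a) n)"
    by (intro cpa.p_closed E_strict_upper)
  then show ?case using 2 by (simp add: strict_upper_simps)
next
  case (3 k l a b i j)
  then show ?case by (simp add: cpa_comm E_strict_upper)
next
  case (4 k l a b d i j)
  then show ?case
    using derivation_index[of "E k l" a b b d i j] E_strict_upper[of k l]
    by (simp only: commutator_elem_mats)
next
  case (5 k l a b c d i j)
  then show ?case
    using derivation_index[of "E k l" a b c d i j] E_strict_upper[of k l]
    by (simp add: commutator_elem_mats_zero product_zero)
next
  case (6 k l a b d i j)
  let ?x = "E a b" and ?y = "E b d" and ?z = "E k l"
  have E: "?x \<in> carrier (strict_upper TYPE('a) n)" "?y \<in> carrier (strict_upper TYPE('a) n)"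
    "?z \<in> carrier (strict_upper TYPE('a) n)"
    using 6 E_strict_upper by auto
  have pE: "p ?y ?z \<in> carrier (strict_upper TYPE('a) n)" "p ?x ?z \<in> carrier (strict_upper TYPE('a) n)"
    using E cpa.p_closed by auto
  have "p (E a d) ?z = p ?x (p ?y ?z) - p ?y (p ?x ?z)"
    using cpa_bracket_left[OF E] 6
      strict_upper_minus[OF cpa.p_closed[OF E(1) pE(1)] cpa.p_closed[OF E(2) pE(2)]]
    by (simp add: commutator_elem_mats)
  then have "p (E a d) ?z $$ (i, j) = p ?x (p ?y ?z) $$ (i, j) - p ?y (p ?x ?z) $$ (i, j)"
    using product_carrier[OF E(2) pE(2)] 6 by simp
  then show ?case
    unfolding product_expand[OF E(1) pE(1) 6(6,7)] product_expand[OF E(2) pE(2) 6(6,7)]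
    by (simp add: sum_subtractf split_def)
qed

interpretation constants: cpa_constants n "\<lambda>k l a b i j. p (E k l) (E a b) $$ (i, j)"
  by (rule strict_upper_constants)

text \<open>Both factors are expanded, the left one after a swap. Only units in the support of y
  occur, which lets a degree condition on y enter.\<close>

lemma product_index_zero:
  assumes x: "x \<in> carrier (strict_upper TYPE('a) n)" and y: "y \<in> carrier (strict_upper TYPE('a) n)"
    and ij: "i < n" "j < n"
    and zero: "\<And>k l u v. \<lbrakk>k < l; l < n; u < v; v < n; y $$ (u, v) \<noteq> 0\<rbrakk>
      \<Longrightarrow> p (E k l) (E u v) $$ (i, j) = 0"
  shows "p x y $$ (i, j) = 0"
proof -
  have neq: "a < b" if "A \<in> carrier (strict_upper TYPE('a) n)" "a < n" "b < n" "A $$ (a, b) \<noteq> 0" for A a b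
    using that by (auto simp: strict_upper_simps not_less[symmetric])
  have "y $$ (u, v) * p x (E u v) $$ (i, j) = 0" if uv: "u < n" "v < n" for u v
  proof (cases "y $$ (u, v) = 0")
    case False
    then have E: "E u v \<in> carrier (strict_upper TYPE('a) n)" and "u < v"
      using neq[OF y uv] E_strict_upper by auto
    have "p x (E u v) $$ (i, j) = p (E u v) x $$ (i, j)" using cpa_comm[OF x E] by simp
    also have "\<dots> = (\<Sum>(k, l)\<in>{..<n} \<times> {..<n}. x $$ (k, l) * p (E u v) (E k l) $$ (i, j))"
      by (rule product_expand[OF E x ij])
    also have "\<dots> = 0"
    proof -
      have "x $$ (k, l) * p (E u v) (E k l) $$ (i, j) = 0" if kl: "k < n" "l < n" for k l
      proof (cases "x $$ (k, l) = 0")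
        case nz: False
        then have "k < l" using neq[OF x] kl by simp
        then have "p (E u v) (E k l) $$ (i, j) = 0"
          using zero[of k l u v] kl uv \<open>u < v\<close> False cpa_comm[OF E E_strict_upper[of k l]] by simp
        then show ?thesis by simp
      qed simp
      then show ?thesis by (intro sum.neutral) auto
    qed
    finally show ?thesis by simp
  qed simp
  then show ?thesis unfolding product_expand[OF x y ij] by (intro sum.neutral) auto
qed

section \<open>The degree filtration and the three claims\<close>

text \<open>The lower central series in explicit form, shifted by one because strictly upper entries
  already have degree at least 1: \<open>filtered (Suc m)\<close> corresponds to
  \<open>lower_central\<close> at m.\<close>

definition filtered :: "nat \<Rightarrow> 'a mat set"
  where "filtered k = {A \<in> carrier (strict_upper TYPE('a) n). \<forall>i<n. \<forall>j<n. j < i + k \<longrightarrow> A $$ (i, j) = 0}"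

lemma filtered_submodule: "submodule class_ring (filtered k) (strict_upper TYPE('a) n)"
  by unfold_locales (auto simp: filtered_def strict_upper_simps)

lemma span_filtered: "S \<subseteq> filtered k \<Longrightarrow> span S \<subseteq> filtered k"
  by (rule span_is_subset[OF _ filtered_submodule])

lemma product_filtered:
  assumes "x \<in> carrier (strict_upper TYPE('a) n)" "y \<in> carrier (strict_upper TYPE('a) n)"
  shows "p x y \<in> filtered (n - 2)"
proof -
  have "p x y $$ (i, j) = 0" if "i < n" "j < n" "j < i + (n - 2)" for i j
    using assms that(1,2) by (rule product_index_zero) (use that in \<open>auto intro: constants.product_corner\<close>)
  then show ?thesis using cpa.p_closed[OF assms] by (simp add: filtered_def)
qed

lemma product_filtered_2:
  assumes x: "x \<in> carrier (strict_upper TYPE('a) n)" and y: "y \<in> filtered 2"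
  shows "p x y = 0\<^sub>m n n"
proof -
  have y': "y \<in> carrier (strict_upper TYPE('a) n)" using y by (simp add: filtered_def)
  have "p x y $$ (i, j) = 0" if ij: "i < n" "j < n" for i j
  proof (rule product_index_zero[OF x y' ij])
    fix k l u v assume A: "k < l" "l < n" "u < v" "v < n" "y $$ (u, v) \<noteq> 0"
    then have "\<not> v < u + 2" using y by (auto simp: filtered_def)
    \<comment> \<open>\<open>product_commutator\<close> takes the unit of degree at least 2 on the
      left.\<close>
    then have "p (E u v) (E k l) $$ (i, j) = 0"
      using A ij by (intro constants.product_commutator) auto
    then show "p (E k l) (E u v) $$ (i, j) = 0"
      using A cpa_comm[OF E_strict_upper E_strict_upper] by simp
  qed
  then show ?thesis using product_carrier[OF x y'] by (intro square_mat_eqI) auto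
qed

text \<open>For j < i + 2 every k satisfies k \<le> i or j \<le> k, so each summand of either matrix
  product has a zero factor.\<close>

lemma commutator_filtered:
  assumes x: "x \<in> carrier (strict_upper TYPE('a) n)" and y: "y \<in> carrier (strict_upper TYPE('a) n)"
  shows "mat_commutator x y \<in> filtered 2"
proof -
  have mult: "(A * B) $$ (i, j) = 0"
    if "A \<in> carrier (strict_upper TYPE('a) n)" "B \<in> carrier (strict_upper TYPE('a) n)"
      "i < n" "j < n" "j < i + 2" for A B i j
  proof -
    have "A $$ (i, k) * B $$ (k, j) = 0" if "k < n" for k
    proof (cases "k \<le> i")
      case False
      then have "j \<le> k" using \<open>j < i + 2\<close> by simp
      then show ?thesis using \<open>B \<in> _\<close> \<open>k < n\<close> \<open>j < n\<close> by (simp add: strict_upper_simps)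
    qed (use \<open>A \<in> _\<close> \<open>k < n\<close> \<open>i < n\<close> in \<open>simp add: strict_upper_simps\<close>)
    then show ?thesis
      using that strict_upper_carrier_mat[OF that(1)] strict_upper_carrier_mat[OF that(2)]
      by (auto simp: scalar_prod_def intro!: sum.neutral)
  qed
  have "mat_commutator x y $$ (i, j) = 0" if "i < n" "j < n" "j < i + 2" for i j
    using commutator_index[of x n y i j] strict_upper_carrier_mat x y that
      mult[OF x y that] mult[OF y x that] by simp
  then show ?thesis using p_closed[OF x y] by (simp add: filtered_def)
qed

lemma strict_upper_associative: "cpa_associative class_ring (strict_upper TYPE('a) n) mat_commutator p"
proof -
  let ?U = "carrier (strict_upper TYPE('a) n)"
  let ?G = "product_space class_ring (strict_upper TYPE('a) n) mat_commutator ?U ?U"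
  have "?G \<subseteq> filtered 2"
    unfolding product_space_def by (rule span_filtered) (auto intro: commutator_filtered)
  then have "{p x y |x y. x \<in> ?U \<and> y \<in> ?G} \<subseteq> filtered n"
    using product_filtered_2 by (auto simp: filtered_def strict_upper_simps)
  then have "product_space class_ring (strict_upper TYPE('a) n) p ?U ?G \<subseteq> filtered n"
    unfolding product_space_def by (rule span_filtered)
  \<comment> \<open>No position satisfies j - i \<ge> n.\<close>
  moreover have "filtered n = {0\<^sub>m n n}"
    by (auto simp: filtered_def strict_upper_simps intro!: square_mat_eqI)
  moreover have "0\<^sub>m n n \<in> product_space class_ring (strict_upper TYPE('a) n) p ?U ?G"
    unfolding product_space_def using span_zero by (simp add: strict_upper_simps)
  ultimately show ?thesis unfolding cpa_associative_def by (auto simp: strict_upper_simps)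
qed

lemma lower_central_carrier:
  "lower_central class_ring (strict_upper TYPE('a) n) mat_commutator m \<subseteq> carrier (strict_upper TYPE('a) n)"
proof (induction m)
  case (Suc m)
  then show ?case
    unfolding lower_central.simps product_space_def by (intro span_is_subset2) (auto intro: p_closed)
qed simp

text \<open>A unit of degree at least m + 2 is \<open>[e_a, E_(a+1,b)]\<close>, whose second
  argument has degree at least m + 1; linearity does the rest.\<close>

lemma filtered_lower_central:
  "filtered (Suc m) \<subseteq> lower_central class_ring (strict_upper TYPE('a) n) mat_commutator m"
proof (induction m)
  case 0
  then show ?case by (auto simp: filtered_def)
next
  case (Suc m)
  let ?L = "lower_central class_ring (strict_upper TYPE('a) n) mat_commutator"
  let ?S = "{mat_commutator x y |x y. x \<in> carrier (strict_upper TYPE('a) n) \<and> y \<in> ?L m}"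
  have S: "?S \<subseteq> carrier (strict_upper TYPE('a) n)"
    using lower_central_carrier by (auto intro: p_closed)
  have L: "?L (Suc m) = span ?S" by (simp add: product_space_def)
  interpret L: submodule class_ring "?L (Suc m)" "strict_upper TYPE('a) n"
    unfolding L by (rule span_is_submodule[OF S])
  show ?case
  proof
    fix A assume A: "A \<in> filtered (Suc (Suc m))"
    then have "A \<in> carrier (strict_upper TYPE('a) n)" by (simp add: filtered_def)
    then show "A \<in> ?L (Suc m)"
    proof (induction rule: strict_upper_induct)
      case zero
      then show ?case using L.zero_closed by (simp only: strict_upper_simps)
    next
      case (add A B)
      then show ?case using L.m_closed[of A B] by (simp only: strict_upper_simps)
    next
      case (smult c A)
      then show ?case using L.smult_closed[of c A] by (simp only: strict_upper_simps class_ring_simps UNIV_I)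
    next
      case (elem a b)
      then have ab: "a + m + 2 \<le> b" using A by (auto simp: filtered_def not_less[symmetric])
      then have "E (Suc a) b \<in> filtered (Suc m)"
        using E_strict_upper[of "Suc a" b] by (auto simp: filtered_def elem_mat_index)
      then have "mat_commutator (E a (Suc a)) (E (Suc a) b) \<in> ?S"
        using Suc E_strict_upper[of a "Suc a"] by blast
      moreover have "mat_commutator (E a (Suc a)) (E (Suc a) b) = E a b"
        using elem ab by (intro commutator_elem_mats) auto
      ultimately have "E a b \<in> ?S" by (simp only:)
      then show ?case unfolding L using in_own_span[OF S] by blast
    qed
  qed
qed

lemma product_lower_central:
  "product_space class_ring (strict_upper TYPE('a) n) p
      (carrier (strict_upper TYPE('a) n)) (carrier (strict_upper TYPE('a) n))
    \<subseteq> lower_central class_ring (strict_upper TYPE('a) n) mat_commutator (n - 3)"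
proof -
  have "Suc (n - 3) = n - 2" using n_ge by simp
  then have "filtered (n - 2) \<subseteq> lower_central class_ring (strict_upper TYPE('a) n) mat_commutator (n - 3)"
    using filtered_lower_central[of "n - 3"] by simp
  moreover have "product_space class_ring (strict_upper TYPE('a) n) p
      (carrier (strict_upper TYPE('a) n)) (carrier (strict_upper TYPE('a) n)) \<subseteq> filtered (n - 2)"
    unfolding product_space_def by (rule span_filtered) (auto intro: product_filtered)
  ultimately show ?thesis by blast
qed

text \<open>Commutativity makes the Poisson bracket zero and, 2 being invertible,
  \<open>circ\<close> equal to the product. Associativity holds because triple products vanish: a
  product has degree at least n - 2 \<ge> 2.\<close>

lemma strict_upper_poisson_admissible: "poisson_admissible class_ring (strict_upper TYPE('a) n) p"
proof -
  let ?V = "strict_upper TYPE('a) n" and ?K = "class_ring :: 'a ring"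
  define br where "br = (\<lambda>x y. p x y \<ominus>\<^bsub>?V\<^esub> p y x)"
  define circ where "circ = (\<lambda>x y. inv\<^bsub>?K\<^esub> (\<one>\<^bsub>?K\<^esub> \<oplus>\<^bsub>?K\<^esub> \<one>\<^bsub>?K\<^esub>) \<odot>\<^bsub>?V\<^esub> (p x y \<oplus>\<^bsub>?V\<^esub> p y x))"
  have br: "br x y = \<zero>\<^bsub>?V\<^esub>" if "x \<in> carrier ?V" "y \<in> carrier ?V" for x y
    using product_carrier[OF that] minus_r_inv_mat[of "p x y" n n]
    unfolding br_def cpa_comm[OF that(2,1)] strict_upper_minus[OF cpa.p_closed[OF that] cpa.p_closed[OF that]]
    by (simp add: strict_upper_simps)
  have circ: "circ x y = p x y" if "x \<in> carrier ?V" "y \<in> carrier ?V" for x y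
  proof (rule square_mat_eqI)
    show "circ x y \<in> carrier_mat n n" "p x y \<in> carrier_mat n n"
      using product_carrier[OF that]
      unfolding circ_def cpa_comm[OF that(2,1)] by (simp_all add: strict_upper_simps)
    show "circ x y $$ (i, j) = p x y $$ (i, j)" if "i < n" "j < n" for i j
      using \<open>p x y \<in> carrier_mat n n\<close> that
      unfolding circ_def cpa_comm[OF \<open>y \<in> _\<close> \<open>x \<in> _\<close>]
      by (simp add: strict_upper_simps class_ring_simps flip: mult_2)
  qed
  have zero: "p x (p y z) = \<zero>\<^bsub>?V\<^esub>" if "x \<in> carrier ?V" "y \<in> carrier ?V" "z \<in> carrier ?V" for x y z
  proof -
    have "p y z \<in> filtered 2"
      using product_filtered[OF that(2,3)] n_ge by (auto simp: filtered_def)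
    then show ?thesis using product_filtered_2[OF that(1)] by (simp add: strict_upper_simps)
  qed
  have zero': "p x \<zero>\<^bsub>?V\<^esub> = \<zero>\<^bsub>?V\<^esub>" "p \<zero>\<^bsub>?V\<^esub> x = \<zero>\<^bsub>?V\<^esub>" if "x \<in> carrier ?V" for x
    using product_zero[OF that] cpa_comm[OF that, of "\<zero>\<^bsub>?V\<^esub>"] by (simp_all add: strict_upper_simps(3) strict_upper_zero)
  have "poisson_algebra class_ring ?V circ br"
  proof (intro poisson_algebra.intro poisson_algebra_axioms.intro lie_algebra.intro bilinear_algebra.intro
      bilinear_algebra_axioms.intro lie_algebra_axioms.intro strict_upper_vectorspace, goal_cases)
    \<comment> \<open>This goal is associativity of \<open>circ\<close>; both sides are
      zero.\<close>
    case (14 x y z)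
    then show ?case by (simp add: circ cpa.p_closed zero cpa_comm[of "p x y" z])
  qed (simp_all add: br circ zero' cpa.p_closed cpa.p_add_left cpa.p_add_right cpa.p_smult_left
      cpa.p_smult_right cpa_comm)
  then show ?thesis
    unfolding poisson_admissible_def br_def circ_def using cpa.bilinear_algebra_axioms by simp
qed

end

theorem theorem4p2:
  fixes n :: nat and p :: "'a :: field_char_0 mat \<Rightarrow> 'a mat \<Rightarrow> 'a mat"
  assumes "n \<ge> 5"
    and "cpa_structure class_ring (strict_upper TYPE('a) n) mat_commutator p"
  shows "cpa_associative class_ring (strict_upper TYPE('a) n) mat_commutator p
    \<and> poisson_admissible class_ring (strict_upper TYPE('a) n) p
    \<and> product_space class_ring (strict_upper TYPE('a) n) p
        (carrier (strict_upper TYPE('a) n)) (carrier (strict_upper TYPE('a) n))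
      \<subseteq> lower_central class_ring (strict_upper TYPE('a) n) mat_commutator (n - 3)"
  using strict_upper_associative[OF assms] strict_upper_poisson_admissible[OF assms] product_lower_central[OF assms] by blast

end
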